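(* Let $M\in\mathbb{R}^{p\times q}$ be nonzero with largest singular value $\sigma_1$, let $0<\alpha<2/\sigma_1^2$, and let $\{X_k\}_{k\ge0}\subset\mathbb{R}^{q\times p}$ be generated by $X_0=\alpha M^T$, $X_{k+1}=X_k(2I_p-MX_k)=2X_k-X_kMX_k$. Let $E_k:=X_k-M^\dagger$. Then for every $k\ge 0$ $$E_{k+1}=-E_kME_k,$$ and therefore $$\|E_{k+1}\|_F\leq\|M\|_2\|E_k\|_F^2 .$$ Moreover, $MX_k$ and $X_kM$ are symmetric for every $k$, and the limit $M^\dagger$ of $(X_k)$ satisfies all four real Penrose equations: $MM^\dagger M=M$, $M^\dagger MM^\dagger=M^\dagger$, $(MM^\dagger)^T=MM^\dagger$, $(M^\dagger M)^T=M^\dagger M$.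
   Context: $M^\dagger$ is the usual Moore--Penrose inverse of a real matrix; $\|\cdot\|_2$ is the spectral norm and $\|\cdot\|_F$ the Frobenius norm. *)

theory Defs
  imports "HOL-Analysis.Analysis"
begin

text \<open>
  A real \<open>p \<times> q\<close> matrix has type \<^typ>\<open>real^'q^'p\<close>: in HOL-Analysis the outer index is the row index.
\<close>

definition penrose_inverse :: "real^'q^'p \<Rightarrow> real^'p^'q \<Rightarrow> bool" where
  "penrose_inverse M Y \<longleftrightarrow>
     M ** Y ** M = M \<and> Y ** M ** Y = Y \<and>
     transpose (M ** Y) = M ** Y \<and> transpose (Y ** M) = Y ** M"

lemma penrose_inverse_unique:
  fixes M :: "real^'q^'p"
  assumes Y: "penrose_inverse M Y" and Z: "penrose_inverse M Z"
  shows "Y = Z"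
proof -
  have y: "M ** Y ** M = M" "Y ** M ** Y = Y" "transpose (M ** Y) = M ** Y" "transpose (Y ** M) = Y ** M"
    using Y by (auto simp: penrose_inverse_def)
  have z: "M ** Z ** M = M" "Z ** M ** Z = Z" "transpose (M ** Z) = M ** Z" "transpose (Z ** M) = Z ** M"
    using Z by (auto simp: penrose_inverse_def)
  have "M ** Y = transpose ((M ** Z ** M) ** Y)"
    using y z by simp
  also have "\<dots> = transpose (M ** Y) ** transpose (M ** Z)"
    by (metis matrix_mul_assoc matrix_transpose_mul)
  also have "\<dots> = M ** Z"
    using y z by (simp add: matrix_mul_assoc)
  finally have MY: "M ** Y = M ** Z" .
  have "Y ** M = transpose (Y ** (M ** Z ** M))"
    using y z by simp
  also have "\<dots> = transpose (Z ** M) ** transpose (Y ** M)"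
    by (metis matrix_mul_assoc matrix_transpose_mul)
  also have "\<dots> = Z ** M"
    using y z by (metis matrix_mul_assoc)
  finally have YM: "Y ** M = Z ** M" .
  have "Y = Z ** M ** Y"
    using y(2) YM by simp
  also have "\<dots> = Z"
    using MY z(2) by (metis matrix_mul_assoc)
  finally show ?thesis .
qed

text \<open>
  The Moore--Penrose inverse is the unique solution of the four Penrose equations.  That a solution
  exists is not built into the definition.
\<close>

definition pinv :: "real^'q^'p \<Rightarrow> real^'p^'q" where
  "pinv M = (THE Y. penrose_inverse M Y)"

text \<open>
  Requiring both a left and a right singular vector yields exactly the diagonal entries of the
  \<open>\<Sigma>\<close> in a singular value decomposition: \<open>0\<close> belongs to the set iff the rank of \<open>M\<close> is
  less than \<open>min p q\<close>.
\<close>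

definition singular_values :: "real^'q^'p \<Rightarrow> real set" where
  "singular_values M =
     {s. s \<ge> 0 \<and> (\<exists>u v. norm u = 1 \<and> norm v = 1 \<and>
            M *v v = s *\<^sub>R u \<and> transpose M *v u = s *\<^sub>R v)}"

definition largest_singular_value :: "real^'q^'p \<Rightarrow> real" where
  "largest_singular_value M = Max (singular_values M)"

text \<open>The norm on \<^typ>\<open>real^'n\<close> is the Euclidean one, so its operator norm is the spectral norm.\<close>

definition spectral_norm :: "real^'q^'p \<Rightarrow> real" where
  "spectral_norm M = onorm (\<lambda>v. M *v v)"

definition frobenius_norm :: "real^'q^'p \<Rightarrow> real" where
  "frobenius_norm M = sqrt (\<Sum>i\<in>UNIV. \<Sum>j\<in>UNIV. (M $ i $ j)\<^sup>2)"

lemma frobenius_norm_eq_norm: "frobenius_norm M = norm M"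
  by (simp add: frobenius_norm_def norm_vec_def L2_set_def sum_nonneg)

end

theory Submission
  imports Defs
begin

text \<open>
  If \<open>G\<close> inverts \<open>M\<close> on the range of \<open>M\<^sup>T\<close> and \<open>H\<close> inverts \<open>M\<^sup>T\<close> on the range of \<open>M\<close>, then
  \<open>G ** M ** H\<^sup>T\<close> solves the Penrose equations; so the Moore--Penrose inverse \<open>Y\<close> exists.
  Since \<open>X\<^sub>k ** M ** Y = X\<^sub>k\<close> and \<open>Y ** M ** X\<^sub>k = X\<^sub>k\<close>, expanding \<open>E\<^sub>k ** M ** E\<^sub>k\<close> gives the error
  recursion.  For convergence, put \<open>P = Y ** M\<close>, the orthogonal projection onto the range
  of \<open>M\<^sup>T\<close>.  The hypothesis on \<open>\<alpha>\<close> makes \<open>E\<^sub>0 ** M = \<alpha> M\<^sup>T ** M - P\<close> a strict contraction, the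
  recursion gives \<open>E\<^bsub>k+1\<^esub> ** M = - (E\<^sub>k ** M)\<^sup>2\<close>, and \<open>E\<^sub>k = E\<^sub>k ** M ** Y\<close>.
\<close>

section \<open>Algebra of matrix products, differences and transposes\<close>

lemma matrix_mul_scaleR_left: "(c *\<^sub>R A) ** B = c *\<^sub>R (A ** B)" for A :: "real^'n^'m"
  by (simp add: scalar_matrix_assoc)

lemma matrix_mul_scaleR_right: "A ** (c *\<^sub>R B) = c *\<^sub>R (A ** B)" for A :: "real^'n^'m"
  by (simp add: matrix_scalar_ac scalar_matrix_assoc)

lemma matrix_diff_ldistrib: "A ** (B - C) = A ** B - A ** C" for A :: "real^'n^'m"
  by (simp add: matrix_eq matrix_vector_mul_assoc[symmetric] matrix_vector_mult_diff_distrib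
      matrix_vector_mult_diff_rdistrib)

lemma matrix_diff_rdistrib: "(A - B) ** C = A ** C - B ** C" for A :: "real^'n^'m"
  by (simp add: matrix_eq matrix_vector_mul_assoc[symmetric] matrix_vector_mult_diff_rdistrib)

lemma transpose_diff: "transpose (A - B) = transpose A - transpose B" for A :: "real^'n^'m"
  by (simp add: transpose_def vec_eq_iff)

lemma minus_matrix_mul: "(- A) ** B = - (A ** B)" for A :: "real^'n^'m"
  using matrix_diff_rdistrib[of 0 A B] by simp

lemma minus_matrix_vector: "(- A) *v x = - (A *v x)" for A :: "real^'n^'m"
  using matrix_vector_mult_diff_rdistrib[of 0 A x] by simp

lemma inner_transpose_matrix_vector: "(transpose A *v x) \<bullet> y = x \<bullet> (A *v y)"
  for A :: "real^'n^'m"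
  by (simp add: dot_lmul_matrix)

section \<open>Existence of the Moore-Penrose inverse\<close>

text \<open>\<open>M\<close> is injective on the range of \<open>transpose M\<close>: a difference
  \<open>transpose M *v w\<close> killed by \<open>M\<close> is orthogonal to itself.
  \<open>G\<close> is the matrix of a linear left inverse there.\<close>

lemma ex_left_inverse_on_range_transpose:
  fixes M :: "real^'q^'p"
  shows "\<exists>G :: real^'p^'q. G ** M ** transpose M = transpose M"
proof -
  let ?V = "range ((*v) (transpose M))"
  have "subspace ?V"
    by (intro linear_subspace_image subspace_UNIV matrix_vector_mul_linear)
  moreover have "inj_on ((*v) M) ?V"
  proof (rule inj_onI)
    fix x y assume xy: "x \<in> ?V" "y \<in> ?V" "M *v x = M *v y"
    then have "x - y \<in> ?V"
      using \<open>subspace ?V\<close> subspace_diff by blast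
    then obtain w where w: "x - y = transpose M *v w"
      by blast
    have "(x - y) \<bullet> (x - y) = w \<bullet> (M *v (x - y))"
      by (subst w) (rule inner_transpose_matrix_vector)
    also have "\<dots> = 0"
      using xy by (simp add: matrix_vector_mult_diff_distrib)
    finally show "x = y"
      by simp
  qed
  ultimately obtain g where g: "linear g" "\<forall>v\<in>?V. g (M *v v) = v"
    using linear_exists_left_inverse_on[of "(*v) M" ?V] by auto
  have "matrix g ** M ** transpose M = transpose M"
    using g by (simp add: matrix_eq matrix_vector_mul_assoc[symmetric] matrix_works
        del: transpose_matrix_vector)
  then show ?thesis ..
qed

text \<open>\<open>A ** transpose A\<close> is always symmetric, so the hypothesis forces
  \<open>A\<close> to be an orthogonal projection.\<close>

lemma symmetric_idempotent_if_mul_transpose_eq: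
  fixes A :: "real^'n^'n"
  assumes "A ** transpose A = transpose A"
  shows "transpose A = A" "A ** A = A"
proof -
  show "transpose A = A"
    using assms by (metis matrix_transpose_mul transpose_transpose)
  then show "A ** A = A"
    using assms by simp
qed

lemma ex_penrose_inverse:
  fixes M :: "real^'q^'p"
  shows "\<exists>Y. penrose_inverse M Y"
proof -
  obtain G :: "real^'p^'q" where G: "G ** M ** transpose M = transpose M"
    using ex_left_inverse_on_range_transpose by blast
  obtain H :: "real^'q^'p" where H: "H ** transpose M ** M = M"
    using ex_left_inverse_on_range_transpose[of "transpose M"] by auto
  have "(G ** M) ** transpose (G ** M) = transpose (G ** M)"
    using G by (simp add: matrix_transpose_mul matrix_mul_assoc)
  note P = symmetric_idempotent_if_mul_transpose_eq[OF this]
  have "(H ** transpose M) ** transpose (H ** transpose M) = transpose (H ** transpose M)"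
    using H by (simp add: matrix_transpose_mul matrix_mul_assoc)
  note Q = symmetric_idempotent_if_mul_transpose_eq[OF this]
  have MHt: "M ** transpose H = H ** transpose M"
    using Q(1) by (simp add: matrix_transpose_mul)
  \<comment> \<open>Transpose the equation \<open>G\<close> and use that \<open>G ** M\<close> is
    symmetric.\<close>
  have MGM: "M ** G ** M = M"
    using G P(1) by (metis matrix_mul_assoc matrix_transpose_mul transpose_transpose)
  have MY: "M ** (G ** M ** transpose H) = H ** transpose M"
    using MGM MHt by (simp add: matrix_mul_assoc)
  have YM: "G ** M ** transpose H ** M = G ** M"
    using H MHt by (metis matrix_mul_assoc)
  have "penrose_inverse M (G ** M ** transpose H)"
    unfolding penrose_inverse_def MY YM
    using H P Q by (simp add: matrix_mul_assoc)
  then show ?thesis ..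
qed

lemma penrose_inverse_pinv: "penrose_inverse M (pinv M)"
  unfolding pinv_def using ex_penrose_inverse penrose_inverse_unique by (metis theI)

section \<open>Spectral norm and largest singular value\<close>

lemma norm_matrix_vector_le_spectral_norm: "norm (A *v x) \<le> spectral_norm A * norm x"
  unfolding spectral_norm_def by (rule onorm) simp

lemma spectral_norm_nonneg: "0 \<le> spectral_norm A"
  unfolding spectral_norm_def by (rule onorm_pos_le) simp

lemma spectral_norm_pos: "A \<noteq> 0 \<Longrightarrow> 0 < spectral_norm A"
  unfolding spectral_norm_def by (subst onorm_pos_lt) (auto simp: matrix_eq)

text \<open>Cauchy-Schwarz bounds the square of the left side by the right side times
  \<open>norm (transpose A *v y)\<close>; one factor then cancels.\<close>

lemma norm_transpose_vector_le_spectral_norm: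
  "norm (transpose A *v y) \<le> spectral_norm A * norm y"
proof -
  have "norm (transpose A *v y) ^ 2 = y \<bullet> (A *v (transpose A *v y))"
    by (metis inner_transpose_matrix_vector power2_norm_eq_inner)
  also have "\<dots> \<le> norm y * (spectral_norm A * norm (transpose A *v y))"
    by (meson norm_cauchy_schwarz order_trans mult_left_mono norm_ge_zero
        norm_matrix_vector_le_spectral_norm)
  finally have "norm (transpose A *v y) * norm (transpose A *v y)
      \<le> (spectral_norm A * norm y) * norm (transpose A *v y)"
    by (simp add: power2_eq_square mult_ac)
  then show ?thesis
    by (cases "norm (transpose A *v y) = 0")
       (auto simp: spectral_norm_nonneg simp del: transpose_matrix_vector)
qed

lemma singular_value_le_spectral_norm:
  assumes "s \<in> singular_values A"
  shows "s \<le> spectral_norm A"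
proof -
  obtain u v where "norm u = 1" "norm v = 1" "A *v v = s *\<^sub>R u" "s \<ge> 0"
    using assms by (auto simp: singular_values_def)
  then show ?thesis
    using norm_matrix_vector_le_spectral_norm[of A v] by simp
qed

text \<open>Gives meaning to the \<open>Max\<close> in \<open>largest_singular_value\<close>. The
  right singular vectors are eigenvectors of \<open>transpose A ** A\<close> with eigenvalue the
  square of \<open>s\<close>. For distinct \<open>s\<close> they are orthogonal, hence independent,
  so the dimension bounds their number.\<close>

lemma finite_singular_values: "finite (singular_values A)"
proof -
  have "\<exists>v. v \<noteq> 0 \<and> transpose A *v (A *v v) = s\<^sup>2 *\<^sub>R v" if s: "s \<in> singular_values A" for s
  proof -
    obtain u v where uv: "norm v = 1" "A *v v = s *\<^sub>R u" "transpose A *v u = s *\<^sub>R v"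
      using s by (auto simp: singular_values_def)
    have "transpose A *v (A *v v) = s *\<^sub>R (transpose A *v u)"
      unfolding uv(2) by (rule matrix_vector_mult_scaleR)
    also have "\<dots> = s\<^sup>2 *\<^sub>R v"
      unfolding uv(3) by (simp add: power2_eq_square)
    finally show ?thesis
      using uv(1) by (intro exI[of _ v]) auto
  qed
  then obtain v where nz: "\<And>s. s \<in> singular_values A \<Longrightarrow> v s \<noteq> 0"
    and eig: "\<And>s. s \<in> singular_values A \<Longrightarrow> transpose A *v (A *v v s) = s\<^sup>2 *\<^sub>R v s"
    by metis
  have orth: "v s \<bullet> v t = 0"
    if st: "s \<in> singular_values A" "t \<in> singular_values A" "s \<noteq> t" for s t
  proof -
    have "s\<^sup>2 * (v s \<bullet> v t) = (A *v v s) \<bullet> (A *v v t)"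
      by (metis eig[OF st(1)] inner_scaleR_left inner_transpose_matrix_vector)
    also have "\<dots> = t\<^sup>2 * (v s \<bullet> v t)"
      by (metis eig[OF st(2)] inner_scaleR_right inner_transpose_matrix_vector
          transpose_transpose)
    finally have "s\<^sup>2 = t\<^sup>2 \<or> v s \<bullet> v t = 0"
      by auto
    \<comment> \<open>Singular values are nonnegative, so squaring separates them.\<close>
    moreover have "s\<^sup>2 \<noteq> t\<^sup>2"
      using st by (auto simp: singular_values_def)
    ultimately show ?thesis
      by simp
  qed
  have "inj_on v (singular_values A)"
    by (rule inj_onI) (metis inner_eq_zero_iff nz orth)
  moreover have "finite (v ` singular_values A)"
  proof -
    have "independent (v ` singular_values A)"
    proof (rule pairwise_orthogonal_independent)
      show "pairwise orthogonal (v ` singular_values A)"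
        using orth unfolding pairwise_image by (auto simp: pairwise_def orthogonal_def)
      show "0 \<notin> v ` singular_values A"
        using nz by force
    qed
    then show ?thesis
      using independent_bound by blast
  qed
  ultimately show ?thesis
    using finite_imageD by blast
qed

text \<open>Compactness of the unit sphere gives a maximizer, and homogeneity extends its bound to
  all vectors.\<close>

lemma ex_spectral_norm_attained:
  fixes A :: "real^'n^'m"
  shows "\<exists>v. norm v = 1 \<and> norm (A *v v) = spectral_norm A"
proof -
  have "sphere (0::real^'n) 1 \<noteq> {}"
    by simp
  moreover have "continuous_on (sphere 0 1) (\<lambda>x. norm (A *v x))"
    by (intro continuous_intros linear_continuous_on matrix_vector_mul_bounded_linear)
  ultimately obtain v
    where v: "norm v = 1" and max: "\<And>w. norm w = 1 \<Longrightarrow> norm (A *v w) \<le> norm (A *v v)"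
    using continuous_attains_sup[of "sphere 0 1" "\<lambda>x. norm (A *v x)"]
    by auto
  have "norm (A *v x) \<le> norm (A *v v) * norm x" for x
  proof (cases "x = 0")
    case False
    then have "norm (A *v ((1 / norm x) *\<^sub>R x)) \<le> norm (A *v v)"
      by (intro max) simp
    then show ?thesis
      using False by (simp add: matrix_vector_mult_scaleR field_simps)
  qed simp
  then have "spectral_norm A \<le> norm (A *v v)"
    unfolding spectral_norm_def by (rule onorm_le)
  then show ?thesis
    using v norm_matrix_vector_le_spectral_norm[of A v] by (intro exI[of _ v]) simp
qed

text \<open>This is the equality case of Cauchy-Schwarz. At a maximizing unit vector
  \<open>v\<close>, the vector \<open>w\<close> has inner product \<open>?s\<^sup>2\<close> with
  \<open>v\<close> and norm at most \<open>?s\<^sup>2\<close>, so it equals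
  \<open>?s\<^sup>2 *\<^sub>R v\<close>. The left singular vector is \<open>A *v v\<close> divided
  by \<open>?s\<close>.\<close>

lemma spectral_norm_in_singular_values:
  fixes A :: "real^'n^'m"
  assumes "A \<noteq> 0"
  shows "spectral_norm A \<in> singular_values A"
proof -
  let ?s = "spectral_norm A"
  obtain v where v: "norm v = 1" "norm (A *v v) = ?s"
    using ex_spectral_norm_attained by blast
  have s: "?s > 0"
    using assms by (rule spectral_norm_pos)
  define w where "w = transpose A *v (A *v v)"
  have wv: "w \<bullet> v = ?s\<^sup>2"
    unfolding w_def inner_transpose_matrix_vector by (metis v(2) power2_norm_eq_inner)
  have "norm w \<le> ?s * ?s"
    unfolding w_def using norm_transpose_vector_le_spectral_norm[of A "A *v v"] v(2) by simp
  then have "w \<bullet> w \<le> ?s\<^sup>2 * ?s\<^sup>2"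
    by (metis mult_mono' norm_ge_zero power2_eq_square power2_norm_eq_inner)
  moreover have "v \<bullet> v = 1"
    using v(1) by (simp add: norm_eq_1)
  ultimately have "(w - ?s\<^sup>2 *\<^sub>R v) \<bullet> (w - ?s\<^sup>2 *\<^sub>R v) \<le> 0"
    using wv by (simp add: inner_diff_left inner_diff_right inner_commute)
  then have w: "w = ?s\<^sup>2 *\<^sub>R v"
    by (metis eq_iff_diff_eq_0 inner_eq_zero_iff inner_ge_zero order_antisym)
  have "transpose A *v ((1 / ?s) *\<^sub>R (A *v v)) = (1 / ?s) *\<^sub>R w"
    unfolding w_def by (rule matrix_vector_mult_scaleR)
  also have "\<dots> = ?s *\<^sub>R v"
    using s w by (simp add: power2_eq_square)
  finally show ?thesis
    unfolding singular_values_def using v s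
    by (intro CollectI conjI exI[of _ "(1 / ?s) *\<^sub>R (A *v v)"] exI[of _ v]) auto
qed

lemma largest_singular_value_eq_spectral_norm:
  "A \<noteq> 0 \<Longrightarrow> largest_singular_value A = spectral_norm A"
  unfolding largest_singular_value_def
  by (intro Max_eqI finite_singular_values singular_value_le_spectral_norm
      spectral_norm_in_singular_values)

section \<open>Frobenius norm estimates for products\<close>

lemma norm_matrix_eq_norm_columns:
  fixes B :: "real^'n^'m"
  shows "(norm B)\<^sup>2 = (\<Sum>j\<in>UNIV. (norm (column j B))\<^sup>2)"
  by (simp add: norm_vec_def L2_set_def sum_nonneg column_def) (rule sum.swap)

text \<open>\<open>A\<close> acts on \<open>B\<close> column by column, and the squared Frobenius
  norm is the sum of the squared column norms.\<close>

lemma norm_matrix_mul_le_spectral_norm: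
  fixes A :: "real^'n^'m" and B :: "real^'l^'n"
  shows "norm (A ** B) \<le> spectral_norm A * norm B"
proof (rule power2_le_imp_le)
  have col: "column j (A ** B) = A *v column j B" for j
    by (simp add: column_def matrix_matrix_mult_def matrix_vector_mult_def)
  have "(norm (A ** B))\<^sup>2 = (\<Sum>j\<in>UNIV. (norm (A *v column j B))\<^sup>2)"
    by (simp add: norm_matrix_eq_norm_columns col)
  also have "\<dots> \<le> (\<Sum>j\<in>UNIV. (spectral_norm A * norm (column j B))\<^sup>2)"
    by (intro sum_mono power_mono norm_matrix_vector_le_spectral_norm norm_ge_zero)
  also have "\<dots> = (spectral_norm A * norm B)\<^sup>2"
    by (simp add: norm_matrix_eq_norm_columns power_mult_distrib sum_distrib_left)
  finally show "(norm (A ** B))\<^sup>2 \<le> (spectral_norm A * norm B)\<^sup>2" .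
qed (simp add: spectral_norm_nonneg)

text \<open>Cauchy-Schwarz applied to each row of \<open>A\<close>.\<close>

lemma spectral_norm_le_norm: "spectral_norm A \<le> norm A"
  unfolding spectral_norm_def
proof (rule onorm_le, rule power2_le_imp_le)
  fix x
  have "(norm (A *v x))\<^sup>2 = (\<Sum>i\<in>UNIV. ((A $ i) \<bullet> x)\<^sup>2)"
    by (simp add: norm_vec_def L2_set_def sum_nonneg matrix_vector_mul_component)
  also have "\<dots> \<le> (\<Sum>i\<in>UNIV. (norm (A $ i) * norm x)\<^sup>2)"
    by (intro sum_mono) (metis Cauchy_Schwarz_ineq2 abs_ge_zero power2_abs power_mono)
  also have "\<dots> = (norm A * norm x)\<^sup>2"
    by (simp add: norm_vec_def[of A] L2_set_def sum_nonneg power_mult_distrib sum_distrib_right)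
  finally show "(norm (A *v x))\<^sup>2 \<le> (norm A * norm x)\<^sup>2" .
qed simp

lemma norm_triple_product_le:
  fixes E :: "real^'p^'q" and M :: "real^'q^'p"
  shows "norm (E ** M ** E) \<le> spectral_norm M * (norm E)\<^sup>2"
proof -
  have "norm (E ** (M ** E)) \<le> spectral_norm E * norm (M ** E)"
    by (rule norm_matrix_mul_le_spectral_norm)
  also have "\<dots> \<le> norm E * (spectral_norm M * norm E)"
    by (intro mult_mono spectral_norm_le_norm norm_matrix_mul_le_spectral_norm) simp_all
  finally show ?thesis
    by (simp add: matrix_mul_assoc power2_eq_square mult_ac)
qed

section \<open>Tools for convergence: projections and the initial contraction\<close>

lemma tendsto_matrix_if_vectors:
  fixes A :: "nat \<Rightarrow> real^'n^'m"
  assumes "\<And>v. (\<lambda>k. A k *v v) \<longlonglongrightarrow> B *v v"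
  shows "A \<longlonglongrightarrow> B"
proof (intro vec_tendstoI)
  fix i j
  show "(\<lambda>k. A k $ i $ j) \<longlonglongrightarrow> B $ i $ j"
    using tendsto_vec_nth[OF assms[of "axis j 1"], of i]
    by (simp add: matrix_vector_mul_component inner_axis)
qed

lemma norm_symmetric_idempotent_le:
  fixes P :: "real^'n^'n"
  assumes "transpose P = P" "P ** P = P"
  shows "norm (P *v x) \<le> norm x"
proof -
  have "norm (P *v x) * norm (P *v x) = x \<bullet> (P *v (P *v x))"
    by (metis assms(1) inner_transpose_matrix_vector power2_norm_eq_inner power2_eq_square)
  also have "\<dots> = x \<bullet> (P *v x)"
    by (simp add: matrix_vector_mul_assoc assms(2))
  also have "\<dots> \<le> norm x * norm (P *v x)"
    by (rule norm_cauchy_schwarz)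
  finally show ?thesis
    by (cases "P *v x = 0") auto
qed

text \<open>The difference sends \<open>x\<close> to \<open>\<alpha> *\<^sub>R w - z\<close>, where
  \<open>z\<close> is the projection of \<open>x\<close>. Expanding the square leaves at most the
  squared norm of \<open>z\<close> minus a positive multiple of that of \<open>M *v z\<close>. Since
  \<open>z = Y *v (M *v z)\<close>, the latter is at least a fixed fraction of the squared norm of
  \<open>z\<close>.\<close>

lemma gradient_step_contraction:
  fixes M :: "real^'q^'p"
  assumes Y: "penrose_inverse M Y"
    and \<alpha>: "0 < \<alpha>" "\<alpha> * (spectral_norm M)\<^sup>2 < 2"
  shows "\<exists>r. 0 \<le> r \<and> r < 1 \<and>
    (\<forall>x. norm ((\<alpha> *\<^sub>R transpose M ** M - Y ** M) *v x) \<le> r * norm x)"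
proof -
  define s where "s = spectral_norm M"
  \<comment> \<open>The summand 1 keeps the later division by \<open>K\<close> safe.\<close>
  define K where "K = 1 + (spectral_norm Y)\<^sup>2"
  define d where "d = \<alpha> * (2 - \<alpha> * s\<^sup>2) / K"
  \<comment> \<open>Truncating at 0 keeps the radicand nonnegative even if \<open>d\<close> exceeds
    1.\<close>
  define r where "r = sqrt (max 0 (1 - d))"
  let ?D = "\<alpha> *\<^sub>R transpose M ** M - Y ** M"
  have K: "K > 0"
    unfolding K_def by (simp add: add_pos_nonneg)
  have d: "d > 0"
    using \<alpha> K by (simp add: d_def s_def)
  have MYM: "M ** Y ** M = M" and sym: "transpose (Y ** M) = Y ** M"
    and idem: "(Y ** M) ** (Y ** M) = Y ** M"
    using Y by (auto simp: penrose_inverse_def matrix_mul_assoc)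
  have "norm (?D *v x) \<le> r * norm x" for x
  proof -
    define z where "z = (Y ** M) *v x"
    define w where "w = transpose M *v (M *v z)"
    have Mz: "M *v z = M *v x"
      by (simp add: z_def matrix_vector_mul_assoc matrix_mul_assoc MYM)
    have Yz: "z = Y *v (M *v z)"
      by (simp add: Mz) (simp add: z_def matrix_vector_mul_assoc)
    have D: "?D *v x = \<alpha> *\<^sub>R w - z"
      unfolding w_def Mz
      by (simp add: z_def matrix_vector_mult_diff_rdistrib matrix_mul_scaleR_left
          scaleR_matrix_vector_assoc[symmetric] matrix_vector_mul_assoc[symmetric]
          del: transpose_matrix_vector)
    have "norm z \<le> spectral_norm Y * norm (M *v z)"
      by (subst Yz) (rule norm_matrix_vector_le_spectral_norm)
    then have "(norm z)\<^sup>2 \<le> (spectral_norm Y)\<^sup>2 * (norm (M *v z))\<^sup>2"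
      by (metis norm_ge_zero power_mono power_mult_distrib)
    also have "\<dots> \<le> K * (norm (M *v z))\<^sup>2"
      by (intro mult_right_mono) (auto simp: K_def)
    finally have zK: "(norm z)\<^sup>2 / K \<le> (norm (M *v z))\<^sup>2"
      using K by (simp add: divide_le_eq mult.commute)
    have "norm w \<le> s * norm (M *v z)"
      unfolding w_def s_def by (rule norm_transpose_vector_le_spectral_norm)
    then have ww: "(norm w)\<^sup>2 \<le> s\<^sup>2 * (norm (M *v z))\<^sup>2"
      by (metis norm_ge_zero power_mono power_mult_distrib)
    have wz: "w \<bullet> z = (norm (M *v z))\<^sup>2"
      unfolding w_def inner_transpose_matrix_vector by (simp add: power2_norm_eq_inner)
    have "(norm (?D *v x))\<^sup>2 = \<alpha>\<^sup>2 * (norm w)\<^sup>2 - 2 * \<alpha> * (w \<bullet> z) + (norm z)\<^sup>2"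
      unfolding D power2_norm_eq_inner
      by (simp add: inner_diff_left inner_diff_right inner_commute algebra_simps power2_eq_square)
    also have "\<dots> \<le> \<alpha>\<^sup>2 * (s\<^sup>2 * (norm (M *v z))\<^sup>2) - 2 * \<alpha> * (norm (M *v z))\<^sup>2 + (norm z)\<^sup>2"
      unfolding wz using mult_left_mono[OF ww, of "\<alpha>\<^sup>2"] by simp
    also have "\<dots> = (norm z)\<^sup>2 - \<alpha> * (2 - \<alpha> * s\<^sup>2) * (norm (M *v z))\<^sup>2"
      by (simp add: algebra_simps power2_eq_square)
    also have "\<dots> \<le> (norm z)\<^sup>2 - \<alpha> * (2 - \<alpha> * s\<^sup>2) * ((norm z)\<^sup>2 / K)"
      using \<alpha> zK by (intro diff_left_mono mult_left_mono) (auto simp: s_def)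
    also have "\<dots> = (1 - d) * (norm z)\<^sup>2"
      by (simp add: d_def left_diff_distrib)
    also have "\<dots> \<le> max 0 (1 - d) * (norm x)\<^sup>2"
      using norm_symmetric_idempotent_le[OF sym idem, of x]
      by (intro mult_mono power_mono) (auto simp: z_def)
    finally have "(norm (?D *v x))\<^sup>2 \<le> (r * norm x)\<^sup>2"
      by (simp add: r_def power_mult_distrib)
    then show ?thesis
      by (rule power2_le_imp_le) (simp add: r_def)
  qed
  moreover have "0 \<le> r" "r < 1"
    using d by (auto simp: r_def)
  ultimately show ?thesis
    by blast
qed

section \<open>The iteration, its error recursion and its limit\<close>

theorem corollary4p3:
  fixes M :: "real^'q^'p"
    and \<alpha> \<sigma>\<^sub>1 :: real
    and X E :: "nat \<Rightarrow> real^'p^'q"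
  assumes M_nz: "M \<noteq> 0"
    and sigma1: "\<sigma>\<^sub>1 = largest_singular_value M"
    and alpha_pos: "0 < \<alpha>"
    and alpha_less: "\<alpha> < 2 / \<sigma>\<^sub>1\<^sup>2"
    and X_0: "X 0 = \<alpha> *\<^sub>R transpose M"
    and X_Suc: "\<And>k. X (Suc k) = X k ** (2 *\<^sub>R mat 1 - M ** X k)"
    and E_def: "\<And>k. E k = X k - pinv M"
  shows "(\<forall>k. X (Suc k) = 2 *\<^sub>R X k - X k ** M ** X k) \<and>
         (\<forall>k. E (Suc k) = - (E k ** M ** E k)) \<and>
         (\<forall>k. frobenius_norm (E (Suc k)) \<le> spectral_norm M * (frobenius_norm (E k))\<^sup>2) \<and>
         (\<forall>k. transpose (M ** X k) = M ** X k \<and> transpose (X k ** M) = X k ** M) \<and>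
         X \<longlonglongrightarrow> pinv M \<and>
         M ** pinv M ** M = M \<and>
         pinv M ** M ** pinv M = pinv M \<and>
         transpose (M ** pinv M) = M ** pinv M \<and>
         transpose (pinv M ** M) = pinv M ** M"
proof -
  define Y where "Y = pinv M"
  have pen: "penrose_inverse M Y"
    unfolding Y_def by (rule penrose_inverse_pinv)
  then have Y: "M ** Y ** M = M" "Y ** M ** Y = Y"
    "transpose (M ** Y) = M ** Y" "transpose (Y ** M) = Y ** M"
    by (auto simp: penrose_inverse_def)
  have E: "E k = X k - Y" for k
    by (simp add: E_def Y_def)
  have rec: "X (Suc k) = 2 *\<^sub>R X k - X k ** M ** X k" for k
    by (simp add: X_Suc matrix_diff_ldistrib matrix_mul_scaleR_right matrix_mul_assoc)
  have sym: "transpose (M ** X k) = M ** X k \<and> transpose (X k ** M) = X k ** M" for k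
  proof (induction k)
    case 0
    then show ?case
      by (simp add: X_0 matrix_mul_scaleR_left matrix_mul_scaleR_right transpose_scalar
          matrix_transpose_mul)
  next
    case (Suc k)
    \<comment> \<open>Both products evolve by the polynomial map sending \<open>A\<close> to
      \<open>2 *\<^sub>R A - A ** A\<close>, which preserves symmetry.\<close>
    have "M ** X (Suc k) = 2 *\<^sub>R (M ** X k) - (M ** X k) ** (M ** X k)"
      "X (Suc k) ** M = 2 *\<^sub>R (X k ** M) - (X k ** M) ** (X k ** M)"
      by (simp_all add: rec matrix_diff_ldistrib matrix_diff_rdistrib matrix_mul_scaleR_left
          matrix_mul_scaleR_right matrix_mul_assoc)
    then show ?case
      using Suc by (simp add: transpose_diff transpose_scalar matrix_transpose_mul[of "M ** X k"]
          matrix_transpose_mul[of "X k ** M"])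
  qed
  have inv: "X k ** M ** Y = X k \<and> Y ** M ** X k = X k" for k
  proof (induction k)
    case 0
    \<comment> \<open>Transposes of \<open>M ** Y ** M = M\<close>, using that \<open>M ** Y\<close>
      and \<open>Y ** M\<close> are symmetric.\<close>
    have "transpose M ** M ** Y = transpose M" "Y ** M ** transpose M = transpose M"
      using Y by (metis matrix_mul_assoc matrix_transpose_mul)+
    then show ?case
      by (simp add: X_0 matrix_mul_scaleR_left matrix_mul_scaleR_right)
  next
    case (Suc k)
    have "X k ** M ** X k ** M ** Y = X k ** M ** (X k ** M ** Y)"
      "Y ** M ** (X k ** M ** X k) = (Y ** M ** X k) ** M ** X k"
      by (simp_all add: matrix_mul_assoc)
    then show ?case
      using Suc by (simp add: rec matrix_diff_ldistrib matrix_diff_rdistrib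
          matrix_mul_scaleR_left matrix_mul_scaleR_right)
  qed
  have err: "E (Suc k) = - (E k ** M ** E k)" for k
    using inv[of k] Y(2)
    by (simp add: E rec matrix_diff_ldistrib matrix_diff_rdistrib scaleR_2)
  have quad: "frobenius_norm (E (Suc k)) \<le> spectral_norm M * (frobenius_norm (E k))\<^sup>2" for k
    by (simp add: frobenius_norm_eq_norm err norm_triple_product_le)
  \<comment> \<open>\<open>M \<noteq> 0\<close> makes \<sigma>\<open>\<^sub>1\<close> a positive
    spectral norm, so the denominator in the bound on \<alpha> can be cleared.\<close>
  have "\<alpha> * (spectral_norm M)\<^sup>2 < 2"
    using alpha_less spectral_norm_pos[OF M_nz]
    by (simp add: sigma1 largest_singular_value_eq_spectral_norm[OF M_nz] less_divide_eq)
  then obtain r where r: "0 \<le> r" "r < 1"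
    and contr: "\<And>x. norm ((\<alpha> *\<^sub>R transpose M ** M - Y ** M) *v x) \<le> r * norm x"
    using gradient_step_contraction[OF pen alpha_pos] by blast
  \<comment> \<open>Squaring would even give the exponent \<open>2 ^ k\<close>; a geometric rate is
    enough for the limit. The exponent starts at 1 because \<open>E 0 ** M\<close> already contracts
    by \<open>r\<close>.\<close>
  have bound: "norm ((E k ** M) *v x) \<le> r ^ Suc k * norm x" for k x
  proof (induction k arbitrary: x)
    case 0
    then show ?case
      using contr[of x] by (simp add: E X_0 matrix_diff_rdistrib)
  next
    case (Suc k)
    have "(E (Suc k) ** M) *v x = - ((E k ** M) *v ((E k ** M) *v x))"
      by (simp add: err matrix_vector_mul_assoc matrix_mul_assoc minus_matrix_mul
          minus_matrix_vector)
    then have "norm ((E (Suc k) ** M) *v x) \<le> r ^ Suc k * (r ^ Suc k * norm x)"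
      using Suc[of "(E k ** M) *v x"] Suc[of x] r(1)
      by (smt (verit) mult_left_mono norm_minus_cancel zero_le_power)
    also have "\<dots> = r ^ (Suc k + Suc k) * norm x"
      by (simp only: power_add mult.assoc)
    also have "\<dots> \<le> r ^ Suc (Suc k) * norm x"
      using r by (intro mult_right_mono power_decreasing) auto
    finally show ?case .
  qed
  have "(\<lambda>k. E k *v v) \<longlonglongrightarrow> 0 *v v" for v
  proof -
    \<comment> \<open>\<open>E k = E k ** M ** Y\<close> transfers the decay of
      \<open>E k ** M\<close> to \<open>E k\<close> itself.\<close>
    have "E k *v v = (E k ** M) *v (Y *v v)" for k
      using inv[of k] Y(2) by (simp add: E matrix_diff_rdistrib matrix_vector_mul_assoc)
    then have "norm (E k *v v) \<le> r ^ Suc k * norm (Y *v v)" for k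
      by (simp only: bound)
    moreover have "(\<lambda>k. r ^ Suc k * norm (Y *v v)) \<longlonglongrightarrow> 0"
      using r by (intro tendsto_mult_left_zero LIMSEQ_Suc LIMSEQ_power_zero) simp
    ultimately have "(\<lambda>k. E k *v v) \<longlonglongrightarrow> 0"
      by - (rule Lim_null_comparison, auto simp del: power_Suc)
    then show ?thesis
      by simp
  qed
  then have "E \<longlonglongrightarrow> 0"
    by (rule tendsto_matrix_if_vectors)
  then have "X \<longlonglongrightarrow> Y"
    by (simp add: E[abs_def] LIM_zero_iff)
  then show ?thesis
    using rec err quad sym Y by (simp add: Y_def)
qed

end
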